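(* For every stationary co-stationary set $A\subseteq\omega_1$ (i.e. both $A$ and $\omega_1\setminus A$ are stationary in $\omega_1$), the compact space $Y(A)$ does not belong to the class $L\Sigma(\leq\omega)$.
   Context: Construction of $Y(A)$: let $T(A)$ be the collection of all subsets of $A$ which are closed in $\omega_1$ (these are all countable, since $A$ is co-stationary), ordered by end-extension: $s\leq t$ iff $s$ is an initial segment of $t$. This is a tree. An initial branch of $T(A)$ is a linearly ordered subset of $T(A)$ which is closed downwards. $Y(A)$ is the set of all initial branches of $T(A)$, regarded as a subspace of the Cantor cube $\mathcal P(T(A))\cong 2^{T(A)}$ with the product topology. (It is a compact space.) Class $L\Sigma(\leq\omega)$: all spaces are Tychonoff. A multivalued mapping $p\colon M\to X$ assigns to each $m\in M$ a (possibly empty) subset $p(m)\subseteq X$; it is compact-valued if each $p(m)$ is compact, and upper semicontinuous (usc) if $\{m\in M: p(m)\subseteq V\}$ is open in $M$ for each open $V\subseteq X$; $p(M)=\bigcup_{m\in M}p(m)$. A space $X$ is in $L\Sigma(\leq\omega)$ if there are a second-countable space $M$ and a compact-valued usc mapping $p\colon M\to X$ such that $p(M)=X$ and each $p(m)$ has countable weight (i.e. is metrizable). Equivalently, $X$ has a cover $\mathcal C$ by metrizable compact subsets and a countable family $\mathcal N$ of subsets of $X$ such that for every $C\in\mathcal C$ and every open $U\supseteq C$ there is $N\in\mathcal N$ with $C\subseteq N\subseteq U$. *)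

theory Defs
  imports "HOL-Analysis.Analysis" "HOL-Library.Countable_Set_Type"
begin

unbundle cardinal_syntax

section \<open>The ordinal \<open>\<omega>\<^sub>1\<close>\<close>

text \<open>\<open>cardSuc natLeq\<close> is the successor cardinal of \<open>\<aleph>\<^sub>0\<close>, as a well-order on a set of type
  \<open>nat set set\<close>. The type carries this order and its order topology.\<close>

lemma Field_cardSuc_natLeq_nonempty: "Field (cardSuc natLeq) \<noteq> {}"
  using cardSuc_finite[OF natLeq_Card_order] Field_natLeq by force

typedef omega1 = "Field (cardSuc natLeq)"
  using Field_cardSuc_natLeq_nonempty by blast

lemma wo_cardSuc_natLeq: "Well_order (cardSuc natLeq)"
  using cardSuc_Card_order[OF natLeq_Card_order] card_order_on_def by blast

instantiation omega1 :: linorder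
begin

definition less_eq_omega1 :: "omega1 \<Rightarrow> omega1 \<Rightarrow> bool"
  where "x \<le> y \<longleftrightarrow> (Rep_omega1 x, Rep_omega1 y) \<in> cardSuc natLeq"

definition less_omega1 :: "omega1 \<Rightarrow> omega1 \<Rightarrow> bool"
  where "(x :: omega1) < y \<longleftrightarrow> x \<le> y \<and> x \<noteq> y"

instance
proof
  have lin: "Linear_order (cardSuc natLeq)"
    using wo_cardSuc_natLeq by (simp add: well_order_on_def)
  then have po: "Refl (cardSuc natLeq)" "trans (cardSuc natLeq)" "antisym (cardSuc natLeq)"
    "Total (cardSuc natLeq)"
    by (auto simp: order_on_defs)
  fix x y z :: omega1
  show refl: "x \<le> x"
    using po(1) Rep_omega1 by (simp add: less_eq_omega1_def refl_on_def)
  show anti: "x \<le> y \<Longrightarrow> y \<le> x \<Longrightarrow> x = y"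
    using po(3) by (auto simp: less_eq_omega1_def Rep_omega1_inject dest: antisymD)
  show "x \<le> y \<Longrightarrow> y \<le> z \<Longrightarrow> x \<le> z"
    using po(2) by (auto simp: less_eq_omega1_def dest: transD)
  show "x < y \<longleftrightarrow> x \<le> y \<and> \<not> y \<le> x"
    using refl anti by (auto simp: less_omega1_def)
  show "x \<le> y \<or> y \<le> x"
    using po(4) Rep_omega1[of x] Rep_omega1[of y] refl
    by (cases "x = y") (auto simp: less_eq_omega1_def total_on_def Rep_omega1_inject)
qed

end

instance omega1 :: wellorder
proof
  fix P :: "omega1 \<Rightarrow> bool" and a
  assume step: "\<And>x. (\<And>y. y < x \<Longrightarrow> P y) \<Longrightarrow> P x"
  have "wf (cardSuc natLeq - Id)"
    using wo_cardSuc_natLeq by (simp add: well_order_on_def)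
  then have "wf (inv_image (cardSuc natLeq - Id) Rep_omega1)"
    by (rule wf_inv_image)
  then show "P a"
  proof (induction a rule: wf_induct_rule)
    case (less x)
    show "P x"
    proof (rule step)
      fix y assume "y < x"
      then have "(y, x) \<in> inv_image (cardSuc natLeq - Id) Rep_omega1"
        by (simp add: less_omega1_def less_eq_omega1_def Rep_omega1_inject)
      then show "P y"
        by (rule less)
    qed
  qed
qed

instantiation omega1 :: linorder_topology
begin

definition open_omega1 :: "omega1 set \<Rightarrow> bool"
  where "open_omega1 = generate_topology (range (\<lambda>a :: omega1. {..<a}) \<union> range (\<lambda>a. {a<..}))"

instance
  by standard (rule open_omega1_def)

end

lemma uncountable_omega1: "uncountable (UNIV :: omega1 set)"
proof
  assume "countable (UNIV :: omega1 set)"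
  then have "countable (range Rep_omega1)" by simp
  then have "countable (Field (cardSuc natLeq))"
    using type_definition.Rep_range[OF type_definition_omega1] by simp
  then have "|Field (cardSuc natLeq)| \<le>o natLeq"
    by (simp only: countable_card_le_natLeq)
  moreover have "natLeq <o |Field (cardSuc natLeq)|"
    by (rule ordLess_ordIso_trans[OF cardSuc_greater[OF natLeq_Card_order]
          ordIso_symmetric[OF card_of_Field_ordIso[OF cardSuc_Card_order[OF natLeq_Card_order]]]])
  ultimately show False
    by (rule not_ordLess_ordLeq[THEN notE, rotated])
qed

lemma countable_lessThan_omega1: "countable {..<x :: omega1}"
proof -
  let ?r = "cardSuc natLeq"
  have "|underS ?r (Rep_omega1 x)| <o ?r"
    using card_of_underS[OF cardSuc_Card_order[OF natLeq_Card_order] Rep_omega1] .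
  then have "|underS ?r (Rep_omega1 x)| \<le>o natLeq"
    by (rule iffD1[OF cardSuc_ordLeq_ordLess[OF natLeq_Card_order card_of_Card_order]])
  then have "countable (underS ?r (Rep_omega1 x))"
    by (simp only: countable_card_le_natLeq)
  moreover have "Rep_omega1 ` {..<x} \<subseteq> underS ?r (Rep_omega1 x)"
    by (auto simp: underS_def less_omega1_def less_eq_omega1_def Rep_omega1_inject)
  ultimately have "countable (Rep_omega1 ` {..<x})"
    by (rule countable_subset[rotated])
  then show ?thesis
    by (rule countable_image_inj_on) (simp add: inj_on_def Rep_omega1_inject)
qed


section \<open>Stationary sets\<close>

definition club :: "omega1 set \<Rightarrow> bool"
  where "club C \<longleftrightarrow> closed C \<and> (\<forall>\<alpha>. \<exists>\<beta>\<in>C. \<alpha> < \<beta>)"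

definition stationary :: "omega1 set \<Rightarrow> bool"
  where "stationary S \<longleftrightarrow> (\<forall>C. club C \<longrightarrow> S \<inter> C \<noteq> {})"


section \<open>The tree \<open>T(A)\<close> and the space \<open>Y(A)\<close>\<close>

definition T :: "omega1 set \<Rightarrow> omega1 set set"
  where "T A = {s. s \<subseteq> A \<and> closed s}"

definition end_ext :: "omega1 set \<Rightarrow> omega1 set \<Rightarrow> bool"
  where "end_ext s t \<longleftrightarrow> s \<subseteq> t \<and> (\<forall>\<beta>\<in>s. \<forall>\<alpha>\<in>t. \<alpha> \<le> \<beta> \<longrightarrow> \<alpha> \<in> s)"

text \<open>The empty branch is included, and \<open>{}\<close> is the root of the tree.\<close>

definition initial_branch :: "omega1 set \<Rightarrow> omega1 set set \<Rightarrow> bool"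
  where "initial_branch A b \<longleftrightarrow> b \<subseteq> T A
    \<and> (\<forall>s\<in>b. \<forall>t\<in>b. end_ext s t \<or> end_ext t s)
    \<and> (\<forall>t\<in>b. \<forall>s\<in>T A. end_ext s t \<longrightarrow> s \<in> b)"

text \<open>The Cantor cube \<open>2\<^sup>I\<close>, transported to the power set of \<open>I\<close> along characteristic functions.\<close>

definition cantor_cube :: "'i set \<Rightarrow> 'i set topology"
  where "cantor_cube I = pullback_topology (Pow I) (\<lambda>S. \<lambda>i\<in>I. i \<in> S)
    (product_topology (\<lambda>_. discrete_topology (UNIV :: bool set)) I)"

definition Y :: "omega1 set \<Rightarrow> omega1 set set topology"
  where "Y A = subtopology (cantor_cube (T A)) {b. initial_branch A b}"


section \<open>The class \<open>L\<Sigma>(\<le>\<omega>)\<close>\<close>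

definition tychonoff_space :: "'a topology \<Rightarrow> bool"
  where "tychonoff_space X \<longleftrightarrow> completely_regular_space X \<and> Hausdorff_space X"

definition compact_valued :: "'m topology \<Rightarrow> 'a topology \<Rightarrow> ('m \<Rightarrow> 'a set) \<Rightarrow> bool"
  where "compact_valued M X p \<longleftrightarrow> (\<forall>m\<in>topspace M. compactin X (p m))"

definition usc :: "'m topology \<Rightarrow> 'a topology \<Rightarrow> ('m \<Rightarrow> 'a set) \<Rightarrow> bool"
  where "usc M X p \<longleftrightarrow> (\<forall>V. openin X V \<longrightarrow> openin M {m \<in> topspace M. p m \<subseteq> V})"

text \<open>HOL cannot quantify over the carrier type of \<open>M\<close> inside a formula, so that type is a
  parameter. A space belongs to the class iff the predicate holds for some type \<open>'m\<close>; it fails to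
  belong iff the predicate is false for every \<open>'m\<close>, which is what a theorem
  \<open>\<not> in_LSigma_omega TYPE('m) X\<close> with \<open>'m\<close> free asserts.\<close>

definition in_LSigma_omega :: "'m itself \<Rightarrow> 'a topology \<Rightarrow> bool"
  where "in_LSigma_omega _ X \<longleftrightarrow> tychonoff_space X
    \<and> (\<exists>(M :: 'm topology) p. tychonoff_space M \<and> second_countable M
        \<and> compact_valued M X p \<and> usc M X p
        \<and> (\<Union>m\<in>topspace M. p m) = topspace X
        \<and> (\<forall>m\<in>topspace M. second_countable (subtopology X (p m))))"


section \<open>\<open>Y(A)\<close> is a compact Tychonoff space\<close>

lemma topspace_cantor_cube: "topspace (cantor_cube I) = Pow I"
  by (auto simp: cantor_cube_def topspace_pullback_topology)

lemma homeomorphic_map_cantor_cube: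
  "homeomorphic_map (cantor_cube I) (product_topology (\<lambda>_. discrete_topology (UNIV :: bool set)) I)
    (\<lambda>S. \<lambda>i\<in>I. i \<in> S)"
proof -
  let ?P = "product_topology (\<lambda>_. discrete_topology (UNIV :: bool set)) I"
  let ?f = "\<lambda>S. \<lambda>i\<in>I. i \<in> S"
  have "continuous_map (cantor_cube I) ?P (id \<circ> ?f)"
    unfolding cantor_cube_def by (rule continuous_map_pullback) simp
  moreover have "continuous_map ?P (cantor_cube I) (\<lambda>g. {i\<in>I. g i})"
    unfolding cantor_cube_def
  proof (rule continuous_map_pullback')
    show "continuous_map ?P ?P (?f \<circ> (\<lambda>g. {i\<in>I. g i}))"
      by (rule continuous_map_eq[OF continuous_map_id])
        (auto simp: fun_eq_iff PiE_iff extensional_def)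
  qed auto
  ultimately have "homeomorphic_maps (cantor_cube I) ?P ?f (\<lambda>g. {i\<in>I. g i})"
    by (auto simp: homeomorphic_maps_def topspace_cantor_cube fun_eq_iff PiE_iff extensional_def)
  then show ?thesis
    using homeomorphic_maps_map by blast
qed

lemma compact_space_cantor_cube: "compact_space (cantor_cube I)"
  using homeomorphic_compact_space[OF homeomorphic_map_imp_homeomorphic_space[OF
        homeomorphic_map_cantor_cube]]
  by (simp add: compact_space_product_topology compact_space_discrete_topology)

lemma Hausdorff_space_cantor_cube: "Hausdorff_space (cantor_cube I)"
  using homeomorphic_Hausdorff_space[OF homeomorphic_map_imp_homeomorphic_space[OF
        homeomorphic_map_cantor_cube]]
  by (simp add: Hausdorff_space_product_topology)

lemma clopen_cantor_cube:
  assumes "i \<in> I"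
  shows "closedin (cantor_cube I) {S \<in> Pow I. i \<in> S}" "closedin (cantor_cube I) {S \<in> Pow I. i \<notin> S}"
proof -
  let ?P = "product_topology (\<lambda>_. discrete_topology (UNIV :: bool set)) I"
  have "continuous_map (cantor_cube I) (discrete_topology (UNIV :: bool set))
      ((\<lambda>g. g i) \<circ> (\<lambda>S. \<lambda>i\<in>I. i \<in> S))"
    using homeomorphic_imp_continuous_map[OF homeomorphic_map_cantor_cube]
      continuous_map_product_projection[OF assms]
    by (rule continuous_map_compose)
  from closedin_continuous_map_preimage[OF this, of "{True}"]
    closedin_continuous_map_preimage[OF this, of "{False}"]
  show "closedin (cantor_cube I) {S \<in> Pow I. i \<in> S}" "closedin (cantor_cube I) {S \<in> Pow I. i \<notin> S}"
    using assms by (simp_all add: topspace_cantor_cube)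
qed

lemma topspace_Y: "topspace (Y A) = {b. initial_branch A b}"
  by (auto simp: Y_def topspace_cantor_cube initial_branch_def)

lemma closedin_Y: "closedin (cantor_cube (T A)) {b. initial_branch A b}"
proof -
  let ?X = "cantor_cube (T A)"
  let ?P = "Pow (T A)"
  define N where "N s = {b \<in> ?P. s \<notin> b}" for s
  define M where "M s = {b \<in> ?P. s \<in> b}" for s
  have N: "closedin ?X (N s)" and M: "closedin ?X (M s)" if "s \<in> T A" for s
    using clopen_cantor_cube[OF that] by (simp_all add: N_def M_def)
  define C where "C s t = (if end_ext s t \<or> end_ext t s then ?P else N s \<union> N t)
    \<inter> (if end_ext s t then N t \<union> M s else ?P)" for s t
  have P: "closedin ?X ?P"
    using closedin_topspace[of ?X] by (simp add: topspace_cantor_cube)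
  have C: "closedin ?X (C s t)" if "s \<in> T A" "t \<in> T A" for s t
    unfolding C_def using N M P that by (simp add: closedin_Int closedin_Un)
  have ne: "{} \<in> T A"
    by (simp add: T_def)
  have "closedin ?X (\<Inter>s\<in>T A. \<Inter>t\<in>T A. C s t)"
    using C ne by (intro closedin_INT) auto
  moreover have "(\<Inter>s\<in>T A. \<Inter>t\<in>T A. C s t) = {b. initial_branch A b}"
  proof (intro equalityI subsetI)
    fix b assume b: "b \<in> (\<Inter>s\<in>T A. \<Inter>t\<in>T A. C s t)"
    have C': "b \<in> C s t" if "s \<in> T A" "t \<in> T A" for s t
      using b that by blast
    have sub: "b \<subseteq> T A"
      using C'[OF ne ne] by (auto simp: C_def N_def M_def split: if_splits)
    have "end_ext s t \<or> end_ext t s" if "s \<in> b" "t \<in> b" for s t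
      using C'[OF subsetD[OF sub that(1)] subsetD[OF sub that(2)]] that
      by (auto simp: C_def N_def split: if_splits)
    moreover have "s \<in> b" if "t \<in> b" "s \<in> T A" "end_ext s t" for s t
      using C'[OF that(2) subsetD[OF sub that(1)]] that by (auto simp: C_def N_def M_def)
    ultimately show "b \<in> {b. initial_branch A b}"
      using sub unfolding initial_branch_def by blast
  next
    fix b assume "b \<in> {b. initial_branch A b}"
    then have b: "b \<subseteq> T A" "\<And>s t. s \<in> b \<Longrightarrow> t \<in> b \<Longrightarrow> end_ext s t \<or> end_ext t s"
      "\<And>s t. t \<in> b \<Longrightarrow> s \<in> T A \<Longrightarrow> end_ext s t \<Longrightarrow> s \<in> b"
      unfolding initial_branch_def by blast+
    have "b \<in> C s t" if "s \<in> T A" "t \<in> T A" for s t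
      using b(1) b(2)[of s t] b(3)[of t s] that by (simp add: C_def N_def M_def) blast
    then show "b \<in> (\<Inter>s\<in>T A. \<Inter>t\<in>T A. C s t)"
      by blast
  qed
  ultimately show ?thesis
    by simp
qed

lemma compact_space_Y: "compact_space (Y A)"
  unfolding Y_def
  using closedin_compact_space[OF compact_space_cantor_cube closedin_Y] compact_space_subtopology
  by blast

lemma tychonoff_space_Y: "tychonoff_space (Y A)"
proof -
  have "Hausdorff_space (Y A)"
    unfolding Y_def using Hausdorff_space_cantor_cube Hausdorff_space_subtopology by blast
  then show ?thesis
    using compact_space_Y compact_Hausdorff_or_regular_imp_normal_space
      normal_imp_completely_regular_space
    by (auto simp: tychonoff_space_def)
qed

end

theory Submission
  imports Defs
begin

text \<open>
  Since \<open>A\<close> is stationary, \<open>T A\<close> is a Baire tree: countably many dense upward closed subsets have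
  a common element. If \<open>Y A\<close> had a countable network \<open>\<N>\<close> modulo a cover by metrizable compacta,
  then some \<open>s \<in> T A\<close> would decide every \<open>N \<in> \<N>\<close>: either no branch in \<open>N\<close> passes through \<open>s\<close>, or
  every \<open>t\<close> above \<open>s\<close> lies on a branch in \<open>N\<close>. A member \<open>K\<close> of the cover containing a branch
  through \<open>s\<close> then meets the clopen set \<open>{b. t \<in> b}\<close> for every \<open>t\<close> above \<open>s\<close>. The sets
  \<open>t = s \<union> {\<alpha>}\<close> give uncountably many pairwise disjoint such clopen sets, so \<open>K\<close> is not second
  countable.
\<close>

section \<open>Clubs and stationary sets\<close>

text \<open>Regularity of \<open>omega1\<close>: the initial segments of an unbounded set cover the
  whole type, and each of them is countable.\<close>

lemma countable_bounded_omega1: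
  assumes "countable (S :: omega1 set)"
  shows "\<exists>b. \<forall>x\<in>S. x < b"
proof (rule ccontr)
  assume "\<not> ?thesis"
  then have "(UNIV :: omega1 set) \<subseteq> (\<Union>x\<in>S. insert x {..<x})"
    by (fastforce simp: not_less order_le_less)
  moreover have "countable (\<Union>x\<in>S. insert x {..<x})"
    using assms countable_lessThan_omega1 by (intro countable_UN) auto
  ultimately show False
    using uncountable_omega1 countable_subset by blast
qed

lemma gt_ex_omega1: "\<exists>y. (x :: omega1) < y"
  using countable_bounded_omega1[of "{x}"] by auto

text \<open>There is no largest element, so \<open>{..a}\<close> is the open ray below the successor
  of \<open>a\<close>.\<close>

lemma open_atMost_omega1: "open {..a :: omega1}"
proof -
  define z where "z = (LEAST z. a < z)"
  have "a < z"
    unfolding z_def using gt_ex_omega1 by (rule LeastI_ex)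
  moreover have "z \<le> x" if "a < x" for x
    unfolding z_def using that by (rule Least_le)
  ultimately have "{..a} = {..<z}"
    by (force simp: not_less)
  then show ?thesis
    by simp
qed

lemma stationary_unbounded:
  assumes "stationary S"
  obtains x where "x \<in> S" "\<beta> < x"
proof -
  obtain \<gamma> where \<gamma>: "\<beta> < \<gamma>"
    using gt_ex_omega1 by blast
  have "\<exists>y\<in>{\<gamma>..}. \<alpha> < y" for \<alpha>
    using gt_ex_omega1[of "max \<alpha> \<gamma>"] by (auto intro: less_imp_le)
  then have "club {\<gamma>..}"
    by (simp add: club_def)
  then have "S \<inter> {\<gamma>..} \<noteq> {}"
    using assms by (auto simp: stationary_def)
  then show ?thesis
    using that \<gamma> by (auto intro: less_le_trans)
qed

text \<open>A substitute for a club of elementary submodels. Failure of closure is witnessed by one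
  finite list and persists nearby; closing off omega times gives a closure point above any
  \<open>\<alpha>\<close>.\<close>

lemma club_closure_points:
  fixes g :: "omega1 list \<Rightarrow> omega1"
  shows "club {\<delta>. \<forall>l\<in>lists {..<\<delta>}. g l < \<delta>}" (is "club ?C")
  unfolding club_def
proof (intro conjI allI)
  have "\<exists>U. open U \<and> \<delta> \<in> U \<and> U \<subseteq> - ?C" if \<delta>: "\<delta> \<in> - ?C" for \<delta>
  proof -
    obtain l where l: "l \<in> lists {..<\<delta>}" "\<delta> \<le> g l"
      using \<delta> by (auto simp: not_less)
    \<comment> \<open>Open because \<open>l\<close> is finite; for \<open>x\<close> in
      \<open>?U\<close> the list \<open>l\<close> still lies below \<open>x\<close>, and
      \<open>x \<le> g l\<close>.\<close>
    let ?U = "(\<Inter>x\<in>set l. {x<..}) \<inter> {..g l}"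
    have "open ?U"
      using open_atMost_omega1 by (intro open_Int open_INT) auto
    moreover have "\<delta> \<in> ?U"
      using l by (auto simp: in_lists_conv_set)
    moreover have "?U \<subseteq> - ?C"
    proof
      fix x assume "x \<in> ?U"
      then have "l \<in> lists {..<x}" "\<not> g l < x"
        by (auto simp: in_lists_conv_set)
      then show "x \<in> - ?C"
        by blast
    qed
    ultimately show ?thesis
      by blast
  qed
  then have "open (- ?C)"
    by (subst open_subopen) blast
  then show "closed ?C"
    by (simp add: closed_def)
next
  fix \<alpha> :: omega1
  have "\<exists>b. a < b \<and> (\<forall>l\<in>lists {..a}. g l < b)" for a
  proof -
    have "countable {..a}"
      using countable_lessThan_omega1[of a] by (simp add: ivl_disj_un_singleton(2)[symmetric])
    then have "countable (insert a (g ` lists {..a}))"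
      by auto
    then show ?thesis
      using countable_bounded_omega1 by (metis image_eqI insertCI)
  qed
  \<comment> \<open>\<open>h a\<close> bounds the values of \<open>g\<close> on the countably many
    lists from \<open>{..a}\<close>.\<close>
  then obtain h where h: "\<And>a. a < h a" "\<And>a l. l \<in> lists {..a} \<Longrightarrow> g l < h a"
    by metis
  define a where "a n = (h ^^ n) \<alpha>" for n
  have a_Suc: "a (Suc n) = h (a n)" for n
    by (simp add: a_def)
  have mono: "incseq a"
    using h(1) by (intro incseq_SucI) (simp add: a_Suc less_imp_le)
  \<comment> \<open>The sequence \<open>a\<close> is strictly increasing, so this strict bound is
    its supremum.\<close>
  define \<delta> where "\<delta> = (LEAST d. \<forall>n. a n < d)"
  have "\<exists>d. \<forall>n. a n < d"
    using countable_bounded_omega1[of "range a"] by simp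
  then have ub: "a n < \<delta>" for n
    unfolding \<delta>_def by (rule LeastI2_ex) blast
  have cof: "\<exists>n. x \<le> a n" if "x < \<delta>" for x
    using not_less_Least[OF that[unfolded \<delta>_def]] by (auto simp: not_less)
  have "g l < \<delta>" if l: "l \<in> lists {..<\<delta>}" for l
  proof -
    have "\<exists>n. l \<in> lists {..a n}"
      using l
    proof (induction l)
      case (Cons x l)
      then have "x < \<delta>" "\<exists>k. l \<in> lists {..a k}"
        by auto
      with cof obtain n k where "x \<le> a n" "l \<in> lists {..a k}"
        by blast
      then have "x \<le> a (max n k)" "l \<in> lists {..a (max n k)}"
        using incseqD[OF mono, of n "max n k"] incseqD[OF mono, of k "max n k"]
        by (auto simp: in_lists_conv_set intro: order_trans)
      then show ?case
        by auto
    qed simp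
    then obtain n where "l \<in> lists {..a n}"
      by blast
    then have "g l < a (Suc n)"
      using h(2) by (simp add: a_Suc)
    then show ?thesis
      using ub by (rule less_trans)
  qed
  moreover have "\<alpha> < \<delta>"
    using ub[of 0] by (simp add: a_def)
  ultimately show "\<exists>\<beta>\<in>?C. \<alpha> < \<beta>"
    by blast
qed

section \<open>The tree is Baire\<close>

lemma end_ext_refl: "end_ext s s"
  by (simp add: end_ext_def)

lemma end_ext_trans: "end_ext s t \<Longrightarrow> end_ext t u \<Longrightarrow> end_ext s u"
  unfolding end_ext_def by (meson subset_iff)

text \<open>An unbounded closed subset of \<open>A\<close> would be a club missing the stationary
  set \<open>- A\<close>.\<close>

lemma bounded_of_T:
  assumes "stationary (- A)" "s \<in> T A"
  obtains \<beta> where "\<And>x. x \<in> s \<Longrightarrow> x \<le> \<beta>"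
proof -
  have "\<not> club s"
    using assms by (auto simp: stationary_def T_def)
  then show ?thesis
    using assms(2) that by (auto simp: club_def T_def not_less)
qed

lemma insert_above_in_T:
  assumes "s \<in> T A" "\<alpha> \<in> A"
  shows "insert \<alpha> s \<in> T A"
  using assms by (auto simp: T_def intro: closed_insert)

lemma end_ext_insert_above:
  assumes "\<And>x. x \<in> s \<Longrightarrow> x < \<alpha>"
  shows "end_ext s (insert \<alpha> s)"
  using assms unfolding end_ext_def by (auto dest: leD)

text \<open>A chain of length omega enters every \<open>D n\<close>. Its union need not be closed,
  so the chain is built with supremum \<open>\<delta>\<close> in \<open>A\<close>, and
  \<open>\<delta>\<close> is put on top.\<close>

lemma T_Baire:
  fixes D :: "nat \<Rightarrow> omega1 set set"
  assumes "stationary A" "stationary (- A)"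
    and dense: "\<And>n s. s \<in> T A \<Longrightarrow> \<exists>t\<in>T A. end_ext s t \<and> t \<in> D n"
    and up: "\<And>n s t. s \<in> D n \<Longrightarrow> t \<in> T A \<Longrightarrow> end_ext s t \<Longrightarrow> t \<in> D n"
  obtains s where "s \<in> T A" "\<And>n. s \<in> D n"
proof -
  \<comment> \<open>Density is strengthened: the extension also gets past a prescribed
    \<open>\<beta>\<close>, which later makes the chain cofinal in \<open>\<delta>\<close>.\<close>
  have "\<exists>t\<in>T A. end_ext s t \<and> t \<in> D n \<and> (\<exists>y\<in>t. \<beta> < y)" if s: "s \<in> T A" for n s \<beta>
  proof -
    obtain \<gamma> where \<gamma>: "\<And>x. x \<in> s \<Longrightarrow> x \<le> \<gamma>"
      using bounded_of_T[OF assms(2) s] by blast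
    obtain \<alpha> where \<alpha>: "\<alpha> \<in> A" "max \<beta> \<gamma> < \<alpha>"
      using stationary_unbounded[OF assms(1)] by blast
    have ext: "end_ext s (insert \<alpha> s)"
      using \<gamma> \<alpha> by (intro end_ext_insert_above) (auto intro: le_less_trans)
    obtain t where t: "t \<in> T A" "end_ext (insert \<alpha> s) t" "t \<in> D n"
      using dense[OF insert_above_in_T[OF s \<alpha>(1)]] by blast
    have "\<alpha> \<in> t"
      using t(2) by (auto simp: end_ext_def)
    then show ?thesis
      using t \<alpha>(2) end_ext_trans[OF ext t(2)] by auto
  qed
  then have "\<exists>e. \<forall>n s \<beta>. s \<in> T A \<longrightarrow> e n s \<beta> \<in> T A \<and> end_ext s (e n s \<beta>)
      \<and> e n s \<beta> \<in> D n \<and> (\<exists>y\<in>e n s \<beta>. \<beta> < y)"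
    by (intro choice allI) (metis (no_types))
  then obtain e where e: "\<And>n s \<beta>. s \<in> T A \<Longrightarrow> e n s \<beta> \<in> T A \<and> end_ext s (e n s \<beta>)
      \<and> e n s \<beta> \<in> D n \<and> (\<exists>y\<in>e n s \<beta>. \<beta> < y)"
    by blast
  \<comment> \<open>Indexing by finite lists of ordinals plays the role of a countable elementary submodel: the
    conditions reachable from parameters below \<open>\<delta>\<close> are countably many.\<close>
  define F where "F = rec_list {} (\<lambda>\<beta> l s. e (length l) s \<beta>)"
  have F_Nil: "F [] = {}" and F_Cons: "F (\<beta> # l) = e (length l) (F l) \<beta>" for \<beta> l
    by (simp_all add: F_def)
  have F_T: "F l \<in> T A" for l
    using e by (induction l) (simp_all add: F_Nil F_Cons, simp add: T_def)
  have "\<exists>b. \<forall>x\<in>F l. x \<le> b" for l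
    using bounded_of_T[OF assms(2) F_T] by metis
  then obtain g where g: "\<And>l x. x \<in> F l \<Longrightarrow> x \<le> g l"
    by metis
  \<comment> \<open>The closure points form a club, so stationarity puts one in \<open>A\<close>.
    Every \<open>F l\<close> with \<open>l\<close> below \<open>\<delta>\<close> is then bounded
    below \<open>\<delta>\<close>.\<close>
  obtain \<delta> where \<delta>: "\<delta> \<in> A" "\<And>l. l \<in> lists {..<\<delta>} \<Longrightarrow> g l < \<delta>"
    using assms(1) club_closure_points[of g] unfolding stationary_def by blast
  \<comment> \<open>An enumeration of all ordinals below \<open>\<delta>\<close>; there is at least
    one, namely \<open>g []\<close>.\<close>
  define \<beta> where "\<beta> = from_nat_into {..<\<delta>}"
  have "{..<\<delta>} \<noteq> {}"
    using \<delta>(2)[of "[]"] by auto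
  then have range_\<beta>: "range \<beta> = {..<\<delta>}"
    unfolding \<beta>_def using countable_lessThan_omega1 by (rule range_from_nat_into)
  \<comment> \<open>Reversed because \<open>F\<close> treats the head of a list as the latest
    parameter; the length \<open>n\<close> selects \<open>e n\<close> at the next step.\<close>
  define L where "L n = rev (map \<beta> [0..<n])" for n
  define S where "S n = F (L n)" for n
  have S_Suc: "S (Suc n) = e n (S n) (\<beta> n)" for n
    by (simp add: S_def L_def F_Cons)
  have S_T: "S n \<in> T A" for n
    by (simp add: S_def F_T)
  have S_less: "x < \<delta>" if "x \<in> S n" for x n
  proof -
    have "L n \<in> lists {..<\<delta>}"
      using range_\<beta> by (auto simp: L_def in_lists_conv_set)
    then show ?thesis
      using \<delta>(2) g[of x "L n"] that by (auto simp: S_def intro: le_less_trans)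
  qed
  have S_mono: "end_ext (S m) (S n)" if "m \<le> n" for m n
    using that
  proof (induction rule: dec_induct)
    case (step n)
    then show ?case
      using e[OF S_T] end_ext_trans by (metis S_Suc)
  qed (rule end_ext_refl)
  have S_cof: "\<exists>n. \<exists>y\<in>S n. x < y" if x: "x < \<delta>" for x
  proof -
    obtain n where "x = \<beta> n"
      using range_\<beta> x by blast
    then show ?thesis
      using e[OF S_T[of n], of n "\<beta> n"] S_Suc by metis
  qed
  have S_init: "x \<in> S n" if "x \<in> S k" "y \<in> S n" "x \<le> y" for x y n k
    using linear[of k n]
  proof
    assume "k \<le> n"
    then show ?thesis
      using S_mono[of k n] that(1) by (auto simp: end_ext_def)
  next
    assume "n \<le> k"
    then show ?thesis
      using S_mono[of n k] that unfolding end_ext_def by blast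
  qed
  define s where "s = insert \<delta> (\<Union>n. S n)"
  have ext: "end_ext (S n) s" for n
    unfolding end_ext_def
  proof (intro conjI ballI impI)
    show "S n \<subseteq> s"
      by (auto simp: s_def)
  next
    fix y x assume y: "y \<in> S n" and x: "x \<in> s" "x \<le> y"
    have "x \<noteq> \<delta>"
      using S_less[OF y] x(2) by auto
    then show "x \<in> S n"
      using x S_init[OF _ y] by (auto simp: s_def)
  qed
  \<comment> \<open>Below any element of \<open>S n\<close>, the set \<open>s\<close> agrees with
    the closed set \<open>S n\<close>; such elements are cofinal in \<open>\<delta>\<close>, and
    nothing in \<open>s\<close> exceeds \<open>\<delta>\<close>.\<close>
  have "\<exists>U. open U \<and> x \<in> U \<and> U \<subseteq> - s" if x: "x \<in> - s" for x
  proof (cases "x < \<delta>")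
    case True
    then obtain n y where y: "y \<in> S n" "x < y"
      using S_cof by blast
    have "open ({..<y} - S n)"
      using S_T[of n] by (intro open_Diff) (auto simp: T_def)
    moreover have "{..<y} - S n \<subseteq> - s"
    proof
      fix z assume z: "z \<in> {..<y} - S n"
      then have "z \<noteq> \<delta>"
        using S_less[OF y(1)] by auto
      then show "z \<in> - s"
        using z S_init[OF _ y(1), of z] by (auto simp: s_def less_imp_le)
    qed
    ultimately show ?thesis
      using x y by (intro exI[of _ "{..<y} - S n"]) (auto simp: s_def)
  next
    case False
    then have "x \<in> {\<delta><..}"
      using x by (auto simp: s_def not_less order_le_less)
    moreover have "{\<delta><..} \<subseteq> - s"
      using S_less by (auto simp: s_def dest: less_asym)
    ultimately show ?thesis
      using open_greaterThan by blast
  qed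
  then have "open (- s)"
    by (subst open_subopen) blast
  then have s: "s \<in> T A"
    using S_T \<delta>(1) by (auto simp: T_def closed_def s_def)
  moreover have "s \<in> D n" for n
    using up[of "S (Suc n)" n s] e[OF S_T[of n], of n "\<beta> n"] s ext by (metis S_Suc)
  ultimately show ?thesis
    using that by blast
qed

section \<open>Branches\<close>

text \<open>Two initial segments of one linearly ordered set are comparable. This supplies a branch
  through any given condition.\<close>

lemma initial_branch_downset:
  "initial_branch A {t \<in> T A. end_ext t s}"
proof -
  have "end_ext t u \<or> end_ext u t" if "end_ext t s" "end_ext u s" for t u
    using that unfolding end_ext_def by (meson linear subset_iff)
  then show ?thesis
    unfolding initial_branch_def using end_ext_trans by blast
qed

lemma clopen_Y:
  assumes "t \<in> T A"
  shows "openin (Y A) {b. initial_branch A b \<and> t \<in> b}" "openin (Y A) {b. initial_branch A b \<and> t \<notin> b}"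
proof -
  let ?X = "cantor_cube (T A)"
  have "openin ?X (topspace ?X - {S \<in> Pow (T A). t \<notin> S})"
    "openin ?X (topspace ?X - {S \<in> Pow (T A). t \<in> S})"
    using clopen_cantor_cube[OF assms] by blast+
  from this[THEN openin_subtopology_Int[of _ _ "{b. initial_branch A b}"]]
  have "openin (Y A) ((topspace ?X - {S \<in> Pow (T A). t \<notin> S}) \<inter> {b. initial_branch A b})"
    "openin (Y A) ((topspace ?X - {S \<in> Pow (T A). t \<in> S}) \<inter> {b. initial_branch A b})"
    by (simp_all add: Y_def)
  moreover have "(topspace ?X - {S \<in> Pow (T A). t \<notin> S}) \<inter> {b. initial_branch A b}
      = {b. initial_branch A b \<and> t \<in> b}"
    "(topspace ?X - {S \<in> Pow (T A). t \<in> S}) \<inter> {b. initial_branch A b}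
      = {b. initial_branch A b \<and> t \<notin> b}"
    by (auto simp: topspace_cantor_cube initial_branch_def)
  ultimately show "openin (Y A) {b. initial_branch A b \<and> t \<in> b}"
    "openin (Y A) {b. initial_branch A b \<and> t \<notin> b}"
    by simp_all
qed

section \<open>Disjoint open sets and second countability\<close>

lemma second_countable_disjoint_countable:
  assumes "second_countable X"
    and "\<And>i. i \<in> I \<Longrightarrow> openin X (U i)" "\<And>i. i \<in> I \<Longrightarrow> U i \<noteq> {}" "disjoint_family_on U I"
  shows "countable I"
proof -
  obtain \<B> where \<B>: "countable \<B>" "\<And>V x. openin X V \<Longrightarrow> x \<in> V \<Longrightarrow> \<exists>B\<in>\<B>. x \<in> B \<and> B \<subseteq> V"
    using assms(1) unfolding second_countable_def by metis
  have "\<exists>B\<in>\<B>. B \<noteq> {} \<and> B \<subseteq> U i" if "i \<in> I" for i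
    using \<B>(2)[OF assms(2)[OF that]] assms(3)[OF that] by blast
  then obtain f where f: "\<And>i. i \<in> I \<Longrightarrow> f i \<in> \<B> \<and> f i \<noteq> {} \<and> f i \<subseteq> U i"
    by metis
  have "inj_on f I"
  proof (rule inj_onI, rule ccontr)
    fix i j assume ij: "i \<in> I" "j \<in> I" "f i = f j" "i \<noteq> j"
    then have "U i \<inter> U j = {}"
      using assms(4) by (auto simp: disjoint_family_on_def)
    then show False
      using f[OF ij(1)] f[OF ij(2)] ij(3) by auto
  qed
  moreover have "countable (f ` I)"
    using f by (intro countable_subset[OF _ \<B>(1)]) blast
  ultimately show ?thesis
    by (rule countable_image_inj_on[rotated])
qed

text \<open>The conditions \<open>insert \<alpha> s\<close>, with \<open>\<alpha>\<close> in
  \<open>A\<close> beyond a bound of \<open>s\<close>, are pairwise incomparable, so no branch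
  contains two of them. They yield uncountably many disjoint nonempty open subsets of
  \<open>K\<close>.\<close>

lemma not_second_countable_meeting_all:
  assumes "stationary A" "stationary (- A)" "s \<in> T A" "K \<subseteq> {b. initial_branch A b}"
    and meets: "\<And>t. t \<in> T A \<Longrightarrow> end_ext s t \<Longrightarrow> \<exists>b\<in>K. t \<in> b"
  shows "\<not> second_countable (subtopology (Y A) K)"
proof
  assume sc: "second_countable (subtopology (Y A) K)"
  obtain \<gamma> where \<gamma>: "\<And>x. x \<in> s \<Longrightarrow> x \<le> \<gamma>"
    using bounded_of_T[OF assms(2,3)] by blast
  define U where "U \<alpha> = {b. initial_branch A b \<and> insert \<alpha> s \<in> b} \<inter> K" for \<alpha>
  let ?I = "{\<alpha>\<in>A. \<gamma> < \<alpha>}"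
  have above: "x < \<alpha>" if "x \<in> s" "\<alpha> \<in> ?I" for x \<alpha>
    using \<gamma>[OF that(1)] that(2) by auto
  have "countable ?I"
  proof (rule second_countable_disjoint_countable[OF sc])
    fix \<alpha> assume \<alpha>: "\<alpha> \<in> ?I"
    then have t: "insert \<alpha> s \<in> T A"
      using insert_above_in_T[OF assms(3)] by blast
    show "openin (subtopology (Y A) K) (U \<alpha>)"
      unfolding U_def using clopen_Y(1)[OF t] by (rule openin_subtopology_Int)
    show "U \<alpha> \<noteq> {}"
      using meets[OF t end_ext_insert_above] above \<alpha> assms(4) by (auto simp: U_def)
  next
    have "\<alpha> = \<alpha>'" if "\<alpha> \<in> ?I" "\<alpha>' \<in> ?I" "b \<in> U \<alpha>" "b \<in> U \<alpha>'" for \<alpha> \<alpha>' b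
    proof -
      have "end_ext (insert \<alpha> s) (insert \<alpha>' s) \<or> end_ext (insert \<alpha>' s) (insert \<alpha> s)"
        using that(3,4) by (auto simp: U_def initial_branch_def)
      then show ?thesis
        using above[of \<alpha> \<alpha>] above[of \<alpha>' \<alpha>'] that(1,2) by (auto simp: end_ext_def)
    qed
    then show "disjoint_family_on U ?I"
      unfolding disjoint_family_on_def by blast
  qed
  \<comment> \<open>A countable tail of \<open>A\<close> would be bounded, but stationary sets are
    unbounded.\<close>
  then obtain b where b: "\<And>x. x \<in> ?I \<Longrightarrow> x < b"
    using countable_bounded_omega1 by metis
  obtain \<alpha> where "\<alpha> \<in> A" "max \<gamma> b < \<alpha>"
    using stationary_unbounded[OF assms(1)] by blast
  then show False
    using b[of \<alpha>] by auto
qed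

section \<open>Deciding a countable family of sets of branches\<close>

text \<open>A condition failing the second alternative in \<open>D n\<close> has an extension
  satisfying the first. The first persists upwards since branches are closed downwards, the second
  by transitivity, so \<open>T_Baire\<close> applies.\<close>

lemma T_decides:
  fixes N :: "nat \<Rightarrow> omega1 set set set"
  assumes "stationary A" "stationary (- A)" and N: "\<And>n. N n \<subseteq> {b. initial_branch A b}"
  obtains s where "s \<in> T A"
    "\<And>n t b. b \<in> N n \<Longrightarrow> s \<in> b \<Longrightarrow> t \<in> T A \<Longrightarrow> end_ext s t \<Longrightarrow> \<exists>b\<in>N n. t \<in> b"
proof -
  define D where "D n = {s \<in> T A. (\<forall>b\<in>N n. s \<notin> b)
    \<or> (\<forall>t\<in>T A. end_ext s t \<longrightarrow> (\<exists>b\<in>N n. t \<in> b))}" for n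
  have "\<exists>t\<in>T A. end_ext s t \<and> t \<in> D n" if "s \<in> T A" for n s
    using that end_ext_refl unfolding D_def by blast
  moreover have "t \<in> D n" if st: "s \<in> D n" "t \<in> T A" "end_ext s t" for n s t
  proof -
    from st(1) consider "\<forall>b\<in>N n. s \<notin> b" | "\<forall>u\<in>T A. end_ext s u \<longrightarrow> (\<exists>b\<in>N n. u \<in> b)"
      unfolding D_def by blast
    then show ?thesis
    proof cases
      case 1
      have "s \<in> b" if "b \<in> N n" "t \<in> b" for b
        using that st N[of n] unfolding D_def initial_branch_def by blast
      with 1 st(2) show ?thesis
        unfolding D_def by blast
    next
      case 2
      with st(2) end_ext_trans[OF st(3)] show ?thesis
        unfolding D_def by blast
    qed
  qed
  ultimately obtain s where s: "s \<in> T A" "\<And>n. s \<in> D n"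
    using T_Baire[OF assms(1,2), of D] by blast
  show ?thesis
  proof (rule that[OF s(1)])
    fix n t b assume "b \<in> N n" "s \<in> b" "t \<in> T A" "end_ext s t"
    then show "\<exists>b\<in>N n. t \<in> b"
      using s(2)[of n] unfolding D_def by blast
  qed
qed

theorem proposition3p1:
  fixes A :: "omega1 set"
  assumes "stationary A" and "stationary (- A)"
  shows "\<not> in_LSigma_omega TYPE('m) (Y A)"
proof
  assume "in_LSigma_omega TYPE('m) (Y A)"
  then obtain M :: "'m topology" and p where M: "second_countable M" and usc: "usc M (Y A) p"
    and cover: "(\<Union>m\<in>topspace M. p m) = {b. initial_branch A b}"
    and metr: "\<And>m. m \<in> topspace M \<Longrightarrow> second_countable (subtopology (Y A) (p m))"
    unfolding in_LSigma_omega_def topspace_Y by blast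
  obtain \<B> where \<B>: "countable \<B>" "\<And>V. V \<in> \<B> \<Longrightarrow> openin M V"
    "\<And>U m. openin M U \<Longrightarrow> m \<in> U \<Longrightarrow> \<exists>V\<in>\<B>. m \<in> V \<and> V \<subseteq> U"
    using M unfolding second_countable_def by metis
  \<comment> \<open>The empty set is added because \<open>from_nat_into\<close> enumerates only nonempty sets.\<close>
  define B where "B = from_nat_into (insert {} \<B>)"
  have range_B: "range B = insert {} \<B>"
    unfolding B_def using \<B>(1) by (intro range_from_nat_into) auto
  then have "B n \<subseteq> topspace M" for n
    using \<B>(2)[THEN openin_subset] by (metis empty_subsetI insertE rangeI)
  \<comment> \<open>The images of the basic open sets form the countable network for the cover by
    the sets \<open>p m\<close>.\<close>
  then have "(\<Union>m\<in>B n. p m) \<subseteq> {b. initial_branch A b}" for n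
    using cover by blast
  then obtain s where s: "s \<in> T A" "\<And>n t b. b \<in> (\<Union>m\<in>B n. p m) \<Longrightarrow> s \<in> b \<Longrightarrow> t \<in> T A
      \<Longrightarrow> end_ext s t \<Longrightarrow> \<exists>b\<in>(\<Union>m\<in>B n. p m). t \<in> b"
    using T_decides[OF assms, of "\<lambda>n. \<Union>m\<in>B n. p m"] by blast
  obtain b where b: "initial_branch A b" "s \<in> b"
    using initial_branch_downset[of A s] s(1) end_ext_refl by blast
  then obtain m where m: "m \<in> topspace M" "b \<in> p m"
    using cover by blast
  have "\<exists>c\<in>p m. t \<in> c" if t: "t \<in> T A" "end_ext s t" for t
  proof (rule ccontr)
    assume *: "\<not> ?thesis"
    \<comment> \<open>If \<open>p m\<close> missed \<open>t\<close>, upper semicontinuity would give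
      a basic neighbourhood of \<open>m\<close> whose whole image misses \<open>t\<close>. That
      image contains \<open>b\<close>, which passes through \<open>s\<close>, against the choice of
      \<open>s\<close>.\<close>
    let ?W = "{m \<in> topspace M. p m \<subseteq> {b. initial_branch A b \<and> t \<notin> b}}"
    have "openin M ?W"
      using usc clopen_Y(2)[OF t(1)] unfolding usc_def by blast
    moreover have "m \<in> ?W"
      using m(1) cover * by blast
    ultimately obtain n where "m \<in> B n" "B n \<subseteq> ?W"
      using \<B>(3) range_B by (metis (no_types, lifting) insertI2 rangeE)
    then show False
      using s(2)[of b n t] m(2) b(2) t by blast
  qed
  moreover have "p m \<subseteq> {b. initial_branch A b}"
    using cover m(1) by blast
  ultimately show False
    using not_second_countable_meeting_all[OF assms s(1)] metr[OF m(1)] by blast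
qed

end
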